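(* Let $f:X\to Y$ be a perfect open (continuous) surjection. If $X$ is quasi $\kappa$-metrizable, then $Y$ is quasi $\kappa$-metrizable. If $X$ is regularly quasi $\kappa$-metrizable, then $Y$ is regularly quasi $\kappa$-metrizable.
   Context: All topological spaces are assumed Tychonoff and all maps continuous. A map is perfect if it is closed with compact fibers. A set $C\subset X$ is regularly closed if it is the closure of an open set. A quasi $\kappa$-metric on a space $X$ is a non-negative real-valued function $\rho(x,C)$ of a point $x\in X$ and a regularly closed set $C\subset X$ such that: K1)$^*$ for any regularly closed $C$ there is a dense open subset $V$ of $X\setminus C$ such that $\rho(x,C)>0$ iff $x\in V$; K2) if $C\subset C'$, then $\rho(x,C')\le\rho(x,C)$ for every $x\in X$; K3) for every $C$, $\rho(x,C)$ is a continuous function of $x$; K4) $\rho(x,\overline{\bigcup_\alpha C_\alpha})=\inf_\alpha\rho(x,C_\alpha)$ for every $x\in X$ and every increasing transfinite (i.e. well-ordered by index) family $\{C_\alpha\}$ of regularly closed sets in $X$. It is regular if moreover: K5) $\rho(x,C)\le\rho(x,C')+\overline\rho(C',C)$ for any $x\in X$ and any regularly closed $C,C'$, where $\overline\rho(C',C)=\sup\{\rho(y,C):y\in C'\}$. A space is (regularly) quasi $\kappa$-metrizable if it admits a (regular) quasi $\kappa$-metric. *)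

theory Defs
  imports "HOL-Analysis.Analysis"
begin

definition tychonoff_space :: "'a topology \<Rightarrow> bool" where
  "tychonoff_space X \<longleftrightarrow> completely_regular_space X \<and> Hausdorff_space X"

definition regularly_closed :: "'a topology \<Rightarrow> 'a set \<Rightarrow> bool" where
  "regularly_closed X C \<longleftrightarrow> (\<exists>U. openin X U \<and> C = X closure_of U)"

(* A transfinite family is indexed by the field of a well-order r.  Since HOL cannot
   quantify over the index type, indices are drawn from the type 'a set; this loses no
   generality, because only the range of the family matters and that range is itself
   well-ordered by inclusion: see quasi_kappa_metric_transfinite below.
   The family is non-empty, so that the infimum is meaningful. *)
definition increasing_family :: "'a topology \<Rightarrow> 'i rel \<Rightarrow> ('i \<Rightarrow> 'a set) \<Rightarrow> bool" where
  "increasing_family X r C \<longleftrightarrow>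
     Well_order r \<and> Field r \<noteq> {} \<and>
     (\<forall>\<alpha>\<in>Field r. regularly_closed X (C \<alpha>)) \<and>
     (\<forall>\<alpha> \<beta>. (\<alpha>, \<beta>) \<in> r \<longrightarrow> C \<alpha> \<subseteq> C \<beta>)"

(* The values of \<rho> outside topspace X, or at sets that are not regularly closed, are irrelevant. *)
definition quasi_kappa_metric :: "'a topology \<Rightarrow> ('a \<Rightarrow> 'a set \<Rightarrow> real) \<Rightarrow> bool" where
  "quasi_kappa_metric X \<rho> \<longleftrightarrow>
     (\<forall>x\<in>topspace X. \<forall>C. regularly_closed X C \<longrightarrow> 0 \<le> \<rho> x C) \<and>
     (\<forall>C. regularly_closed X C \<longrightarrow>
        (\<exists>V. openin (subtopology X (topspace X - C)) V \<and>
             subtopology X (topspace X - C) closure_of V = topspace X - C \<and>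
             (\<forall>x\<in>topspace X. \<rho> x C > 0 \<longleftrightarrow> x \<in> V))) \<and>
     (\<forall>C C'. regularly_closed X C \<longrightarrow> regularly_closed X C' \<longrightarrow> C \<subseteq> C' \<longrightarrow>
        (\<forall>x\<in>topspace X. \<rho> x C' \<le> \<rho> x C)) \<and>
     (\<forall>C. regularly_closed X C \<longrightarrow> continuous_map X euclideanreal (\<lambda>x. \<rho> x C)) \<and>
     (\<forall>(r :: 'a set rel) C. increasing_family X r C \<longrightarrow>
        (\<forall>x\<in>topspace X.
           \<rho> x (X closure_of (\<Union>\<alpha>\<in>Field r. C \<alpha>)) = (INF \<alpha>\<in>Field r. \<rho> x (C \<alpha>))))"

(* The supremum may be infinite, and is 0 when C' is empty; hence it is taken in ennreal. *)
definition rho_bar :: "('a \<Rightarrow> 'a set \<Rightarrow> real) \<Rightarrow> 'a set \<Rightarrow> 'a set \<Rightarrow> ennreal" where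
  "rho_bar \<rho> C' C = (SUP y\<in>C'. ennreal (\<rho> y C))"

definition regular_quasi_kappa_metric :: "'a topology \<Rightarrow> ('a \<Rightarrow> 'a set \<Rightarrow> real) \<Rightarrow> bool" where
  "regular_quasi_kappa_metric X \<rho> \<longleftrightarrow>
     quasi_kappa_metric X \<rho> \<and>
     (\<forall>x\<in>topspace X. \<forall>C C'. regularly_closed X C \<longrightarrow> regularly_closed X C' \<longrightarrow>
        ennreal (\<rho> x C) \<le> ennreal (\<rho> x C') + rho_bar \<rho> C' C)"

definition quasi_kappa_metrizable :: "'a topology \<Rightarrow> bool" where
  "quasi_kappa_metrizable X \<longleftrightarrow> (\<exists>\<rho>. quasi_kappa_metric X \<rho>)"

definition regularly_quasi_kappa_metrizable :: "'a topology \<Rightarrow> bool" where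
  "regularly_quasi_kappa_metrizable X \<longleftrightarrow> (\<exists>\<rho>. regular_quasi_kappa_metric X \<rho>)"

lemma quasi_kappa_metric_transfinite:
  fixes X :: "'a topology" and r :: "'i rel"
  assumes "quasi_kappa_metric X \<rho>" and C: "increasing_family X r C" and x: "x \<in> topspace X"
  shows "\<rho> x (X closure_of (\<Union>\<alpha>\<in>Field r. C \<alpha>)) = (INF \<alpha>\<in>Field r. \<rho> x (C \<alpha>))"
proof -
  define S where "S = C ` Field r"
  define q where "q = {(A, B). A \<in> S \<and> B \<in> S \<and> A \<subseteq> B}"
  have Fq: "Field q = S"
    unfolding q_def Field_def by auto
  have wo: "Well_order r" and inc: "\<And>\<alpha> \<beta>. (\<alpha>, \<beta>) \<in> r \<Longrightarrow> C \<alpha> \<subseteq> C \<beta>"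
    using C unfolding increasing_family_def by auto
  have lin_r: "Linear_order r"
    using wo by (simp add: well_order_on_def)
  have comparable: "A \<subseteq> B \<or> B \<subseteq> A" if AB: "A \<in> S" "B \<in> S" for A B
  proof -
    obtain a b where ab: "a \<in> Field r" "A = C a" "b \<in> Field r" "B = C b"
      using AB S_def by auto
    have "(a, b) \<in> r \<or> (b, a) \<in> r"
      using lin_r ab
      by (cases "a = b") (auto simp: order_on_defs total_on_def refl_on_def)
    then show ?thesis
      using inc ab by auto
  qed
  have "Linear_order q"
    unfolding order_on_defs Fq refl_on_def trans_def antisym_def total_on_def
    using comparable by (auto simp: q_def)
  moreover have "\<exists>A\<in>T. \<forall>A'\<in>T. (A, A') \<in> q" if T: "T \<subseteq> S" "T \<noteq> {}" for T
  proof -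
    let ?I = "{\<alpha>\<in>Field r. C \<alpha> \<in> T}"
    have "?I \<subseteq> Field r" "?I \<noteq> {}"
      using T S_def by auto
    then have "\<exists>a\<in>?I. \<forall>b\<in>?I. (a, b) \<in> r"
      using wo Linear_order_Well_order_iff[OF lin_r] by blast
    then obtain a where a: "a \<in> ?I" "\<forall>b\<in>?I. (a, b) \<in> r"
      by (rule bexE)
    have "(C a, A') \<in> q" if "A' \<in> T" for A'
    proof -
      obtain b where "b \<in> ?I" "A' = C b"
        using \<open>A' \<in> T\<close> T S_def by auto
      then show ?thesis
        using a inc T by (auto simp: q_def S_def)
    qed
    then show ?thesis
      using a by blast
  qed
  ultimately have "Well_order q"
    using Linear_order_Well_order_iff[of q] unfolding Fq by blast
  then have "increasing_family X q id"
    using C unfolding increasing_family_def Fq by (auto simp: q_def S_def)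
  moreover have "\<forall>(r :: 'a set rel) C. increasing_family X r C \<longrightarrow>
      (\<forall>x\<in>topspace X. \<rho> x (X closure_of (\<Union>\<alpha>\<in>Field r. C \<alpha>)) = (INF \<alpha>\<in>Field r. \<rho> x (C \<alpha>)))"
    using assms(1) unfolding quasi_kappa_metric_def by (elim conjE)
  ultimately have "\<rho> x (X closure_of (\<Union>A\<in>Field q. id A)) = (INF A\<in>Field q. \<rho> x (id A))"
    using x by blast
  then have "\<rho> x (X closure_of (\<Union>A\<in>S. id A)) = (INF A\<in>S. \<rho> x (id A))"
    by (simp only: Fq)
  then show ?thesis
    by (simp add: S_def image_image)
qed

end

theory Submission
  imports Defs
begin

text \<open>
  A (regular) quasi \<open>\<kappa>\<close>-metric \<open>\<rho>\<close> on \<open>X\<close> is pushed forward along \<open>f\<close> by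
  \<open>d(y, C) = sup {\<rho>(x, f\<inverse>(C)) | f(x) = y}\<close>; since \<open>f\<close> is open, \<open>f\<inverse>(C)\<close> is regularly closed.
  The supremum is attained on the compact fibers, so \<open>d(y, C) > 0\<close> exactly on the image of the
  open set belonging to \<open>f\<inverse>(C)\<close> in K1, and this image is open and dense in the complement of \<open>C\<close>
  (with an infimum instead of the supremum density would fail). Openness of \<open>f\<close> makes \<open>d(\<cdot>, C)\<close>
  lower semicontinuous, closedness makes it upper semicontinuous. K4 is a Dini type
  interchange of infimum and supremum over a compact fiber, and K5 is inherited from a point
  at which the supremum is attained.
\<close>

section \<open>Push-forward along a map\<close>

text \<open>The supremum is the conditionally complete one of the reals. It is meaningful for
  continuous \<open>g\<close> and \<open>y\<close> in the base, where a perfect map has a non-empty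
  compact fiber.\<close>

definition fiber_sup :: "'a topology \<Rightarrow> ('a \<Rightarrow> 'b) \<Rightarrow> ('a \<Rightarrow> real) \<Rightarrow> 'b \<Rightarrow> real" where
  "fiber_sup X f g y = (SUP x\<in>{x \<in> topspace X. f x = y}. g x)"

definition pushforward :: "'a topology \<Rightarrow> ('a \<Rightarrow> 'b) \<Rightarrow> ('a \<Rightarrow> 'a set \<Rightarrow> real) \<Rightarrow> 'b \<Rightarrow> 'b set \<Rightarrow> real" where
  "pushforward X f \<rho> y C = fiber_sup X f (\<lambda>x. \<rho> x {x \<in> topspace X. f x \<in> C}) y"

section \<open>Regularly closed sets: preimages and closures of unions\<close>

text \<open>From left to right, openness is used: an open neighbourhood of \<open>x\<close> has an
  open image around \<open>f x\<close>, which therefore meets \<open>S\<close>. Conversely,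
  continuity makes the left-hand side closed.\<close>

lemma open_continuous_vimage_closure_of:
  assumes "continuous_map X Y f" and "open_map X Y f" and "S \<subseteq> topspace Y"
  shows "{x \<in> topspace X. f x \<in> Y closure_of S} = X closure_of {x \<in> topspace X. f x \<in> S}"
proof
  show "{x \<in> topspace X. f x \<in> Y closure_of S} \<subseteq> X closure_of {x \<in> topspace X. f x \<in> S}"
  proof clarsimp
    fix x assume x: "x \<in> topspace X" "f x \<in> Y closure_of S"
    have "\<exists>x'\<in>{x \<in> topspace X. f x \<in> S}. x' \<in> U" if U: "x \<in> U" "openin X U" for U
    proof -
      have "openin Y (f ` U)" "f x \<in> f ` U"
        using assms(2) U by (auto simp: open_map_def)
      then obtain z where "z \<in> S" "z \<in> f ` U"
        using x(2) by (auto simp: in_closure_of)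
      then show ?thesis
        using openin_subset[OF U(2)] by auto
    qed
    then show "x \<in> X closure_of {x \<in> topspace X. f x \<in> S}"
      using x(1) by (auto simp: in_closure_of)
  qed
next
  have "closedin X {x \<in> topspace X. f x \<in> Y closure_of S}"
    using assms(1) by (simp add: closedin_continuous_map_preimage)
  moreover have "{x \<in> topspace X. f x \<in> S} \<subseteq> {x \<in> topspace X. f x \<in> Y closure_of S}"
    using closure_of_subset[OF assms(3)] by auto
  ultimately show "X closure_of {x \<in> topspace X. f x \<in> S} \<subseteq> {x \<in> topspace X. f x \<in> Y closure_of S}"
    by (simp add: closure_of_minimal)
qed

lemma regularly_closed_subset: "regularly_closed X C \<Longrightarrow> C \<subseteq> topspace X"
  by (metis closure_of_subset_topspace regularly_closed_def)

lemma regularly_closed_vimage: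
  assumes "continuous_map X Y f" and "open_map X Y f" and "regularly_closed Y C"
  shows "regularly_closed X {x \<in> topspace X. f x \<in> C}"
proof -
  obtain U where U: "openin Y U" "C = Y closure_of U"
    using assms(3) by (auto simp: regularly_closed_def)
  then have "{x \<in> topspace X. f x \<in> C} = X closure_of {x \<in> topspace X. f x \<in> U}"
    using assms by (simp add: open_continuous_vimage_closure_of openin_subset)
  moreover have "openin X {x \<in> topspace X. f x \<in> U}"
    using assms(1) U(1) by (rule openin_continuous_map_preimage)
  ultimately show ?thesis
    unfolding regularly_closed_def by (intro exI conjI)
qed

text \<open>The union of the open sets that generate the members has the same closure as the union
  of the members. In K4 this makes the limit set an admissible argument of \<rho>.\<close>

lemma regularly_closed_closure_Union:
  assumes "\<And>A. A \<in> \<A> \<Longrightarrow> regularly_closed X A"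
  shows "regularly_closed X (X closure_of \<Union>\<A>)"
proof -
  obtain U where U: "\<And>A. A \<in> \<A> \<Longrightarrow> openin X (U A) \<and> A = X closure_of U A"
    using assms unfolding regularly_closed_def by metis
  have "U A \<subseteq> A" if "A \<in> \<A>" for A
    using U[OF that] closure_of_subset[OF openin_subset] by metis
  then have "X closure_of (\<Union>A\<in>\<A>. U A) \<subseteq> X closure_of \<Union>\<A>"
    by (intro closure_of_mono) auto
  moreover have "\<Union>\<A> \<subseteq> X closure_of (\<Union>A\<in>\<A>. U A)"
  proof
    fix x assume "x \<in> \<Union>\<A>"
    then obtain A where A: "A \<in> \<A>" "x \<in> A"
      by auto
    then have "x \<in> X closure_of U A"
      using U by blast
    then show "x \<in> X closure_of (\<Union>A\<in>\<A>. U A)"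
      using closure_of_mono[of "U A" "\<Union>A\<in>\<A>. U A" X] A(1) by blast
  qed
  then have "X closure_of \<Union>\<A> \<subseteq> X closure_of (\<Union>A\<in>\<A>. U A)"
    by (simp add: closure_of_minimal)
  moreover have "openin X (\<Union>A\<in>\<A>. U A)"
    using U by auto
  ultimately show ?thesis
    unfolding regularly_closed_def by blast
qed

section \<open>Suprema of continuous functions over the fibers of a perfect map\<close>

text \<open>Properness makes the fiber compact and surjectivity makes it non-empty, so the supremum
  is a maximum. Later arguments pick a maximizing point instead of estimating suprema.\<close>

lemma fiber_sup_attained:
  assumes f: "perfect_map X Y f" and g: "continuous_map X euclideanreal g" and y: "y \<in> topspace Y"
  obtains x where "x \<in> topspace X" "f x = y" "fiber_sup X f g y = g x"
    "\<And>x'. \<lbrakk>x' \<in> topspace X; f x' = y\<rbrakk> \<Longrightarrow> g x' \<le> g x"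
proof -
  let ?F = "{x \<in> topspace X. f x = y}"
  have "compactin X ?F"
    using f y by (simp add: perfect_map_def proper_map_def)
  then have "compact (g ` ?F)"
    using image_compactin[OF _ g] by simp
  moreover have "y \<in> f ` topspace X"
    using f y by (simp add: perfect_map_def)
  then have "g ` ?F \<noteq> {}"
    by auto
  ultimately obtain x where x: "x \<in> ?F" "\<And>x'. x' \<in> ?F \<Longrightarrow> g x' \<le> g x"
    using compact_attains_sup[of "g ` ?F"] by blast
  then have "fiber_sup X f g y = g x"
    unfolding fiber_sup_def by (intro cSup_eq_maximum) auto
  with x show thesis
    by (intro that) auto
qed

lemma fiber_sup_upper:
  assumes f: "perfect_map X Y f" and g: "continuous_map X euclideanreal g" and x: "x \<in> topspace X"
  shows "g x \<le> fiber_sup X f g (f x)"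
proof -
  have "f x \<in> topspace Y"
    using f x by (auto simp: perfect_map_def)
  from fiber_sup_attained[OF f g this] x show ?thesis
    by metis
qed

lemma fiber_sup_mono:
  assumes f: "perfect_map X Y f" and g: "continuous_map X euclideanreal g"
    and h: "continuous_map X euclideanreal h" and y: "y \<in> topspace Y"
    and le: "\<And>x. x \<in> topspace X \<Longrightarrow> g x \<le> h x"
  shows "fiber_sup X f g y \<le> fiber_sup X f h y"
proof -
  obtain x where x: "x \<in> topspace X" "f x = y" "fiber_sup X f g y = g x"
    using fiber_sup_attained[OF f g y] by metis
  then show ?thesis
    using le fiber_sup_upper[OF f h x(1)] by force
qed

text \<open>This form turns openness of \<open>f\<close> into lower semicontinuity; with
  \<open>c = 0\<close> it also locates the points where the push-forward is positive.\<close>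

lemma less_fiber_sup_eq_image:
  assumes f: "perfect_map X Y f" and g: "continuous_map X euclideanreal g"
  shows "{y \<in> topspace Y. c < fiber_sup X f g y} = f ` {x \<in> topspace X. c < g x}"
proof
  show "{y \<in> topspace Y. c < fiber_sup X f g y} \<subseteq> f ` {x \<in> topspace X. c < g x}"
  proof clarify
    fix y assume "y \<in> topspace Y" "c < fiber_sup X f g y"
    then show "y \<in> f ` {x \<in> topspace X. c < g x}"
      using fiber_sup_attained[OF f g, of y] by (metis (mono_tags, lifting) image_eqI mem_Collect_eq)
  qed
  show "f ` {x \<in> topspace X. c < g x} \<subseteq> {y \<in> topspace Y. c < fiber_sup X f g y}"
    using fiber_sup_upper[OF f g] f by (fastforce simp: perfect_map_def)
qed

text \<open>Attainment is essential here: a supremum equal to \<open>c\<close> must be realized in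
  the fiber. As \<open>f\<close> is closed, the image is closed, which gives upper
  semicontinuity.\<close>

lemma fiber_sup_ge_eq_image:
  assumes f: "perfect_map X Y f" and g: "continuous_map X euclideanreal g"
  shows "{y \<in> topspace Y. c \<le> fiber_sup X f g y} = f ` {x \<in> topspace X. c \<le> g x}"
proof
  show "{y \<in> topspace Y. c \<le> fiber_sup X f g y} \<subseteq> f ` {x \<in> topspace X. c \<le> g x}"
  proof clarify
    fix y assume "y \<in> topspace Y" "c \<le> fiber_sup X f g y"
    then show "y \<in> f ` {x \<in> topspace X. c \<le> g x}"
      using fiber_sup_attained[OF f g, of y] by (metis (mono_tags, lifting) image_eqI mem_Collect_eq)
  qed
  show "f ` {x \<in> topspace X. c \<le> g x} \<subseteq> {y \<in> topspace Y. c \<le> fiber_sup X f g y}"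
    using fiber_sup_upper[OF f g] f by (fastforce simp: perfect_map_def)
qed

lemma continuous_map_fiber_sup:
  assumes f: "perfect_map X Y f" "open_map X Y f" and g: "continuous_map X euclideanreal g"
  shows "continuous_map Y euclideanreal (fiber_sup X f g)"
proof -
  have "openin Y {y \<in> topspace Y. c < fiber_sup X f g y}" for c
    using f g unfolding less_fiber_sup_eq_image[OF f(1) g]
    by (simp add: open_map_def continuous_map_upper_lower_semicontinuous_lt)
  moreover have "openin Y {y \<in> topspace Y. fiber_sup X f g y < c}" for c
  proof -
    have "closedin Y {y \<in> topspace Y. c \<le> fiber_sup X f g y}"
      using f g unfolding fiber_sup_ge_eq_image[OF f(1) g]
      by (simp add: perfect_map_def proper_map_def closed_map_def continuous_map_upper_lower_semicontinuous_le)
    then have "openin Y (topspace Y - {y \<in> topspace Y. c \<le> fiber_sup X f g y})"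
      by blast
    moreover have "topspace Y - {y \<in> topspace Y. c \<le> fiber_sup X f g y}
        = {y \<in> topspace Y. fiber_sup X f g y < c}"
      by auto
    ultimately show ?thesis
      by simp
  qed
  ultimately show ?thesis
    by (simp add: continuous_map_upper_lower_semicontinuous_lt)
qed

section \<open>A Dini type argument on compact sets\<close>

text \<open>The open sets where \<open>g i < c\<close> cover \<open>K\<close>. Comparability of the
  functions makes them a chain, so the union of a finite subcover is one of its members; the
  subcover is non-empty because \<open>K\<close> is.\<close>

lemma compactin_chain_less:
  fixes g :: "'i \<Rightarrow> 'a \<Rightarrow> real"
  assumes K: "compactin X K" "K \<noteq> {}"
    and g: "\<And>i. i \<in> I \<Longrightarrow> continuous_map X euclideanreal (g i)"
    and chain: "\<And>i j. \<lbrakk>i \<in> I; j \<in> I\<rbrakk> \<Longrightarrow>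
      (\<forall>x\<in>topspace X. g i x \<le> g j x) \<or> (\<forall>x\<in>topspace X. g j x \<le> g i x)"
    and less: "\<And>x. x \<in> K \<Longrightarrow> \<exists>i\<in>I. g i x < c"
  shows "\<exists>i\<in>I. \<forall>x\<in>K. g i x < c"
proof -
  define U where "U i = {x \<in> topspace X. g i x < c}" for i
  have "\<forall>V \<in> U ` I. openin X V"
    using g by (auto simp: U_def continuous_map_upper_lower_semicontinuous_lt)
  moreover have "K \<subseteq> \<Union>(U ` I)"
    using less compactin_subset_topspace[OF K(1)] by (fastforce simp: U_def)
  ultimately obtain \<F> where \<F>: "finite \<F>" "\<F> \<subseteq> U ` I" "K \<subseteq> \<Union>\<F>"
    using K(1) unfolding compactin_def by meson
  have "U i \<subseteq> U j \<or> U j \<subseteq> U i" if "i \<in> I" "j \<in> I" for i j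
    using chain[OF that] by (force simp: U_def)
  then have "A \<subseteq> B \<or> B \<subseteq> A" if "A \<in> U ` I" "B \<in> U ` I" for A B
    using that by (elim imageE) simp
  then have "subset.chain UNIV \<F>"
    unfolding subset_chain_def using \<F>(2) by (simp add: subsetD)
  moreover have "\<F> \<noteq> {}"
    using \<F>(3) K(2) by auto
  ultimately have "\<Union>\<F> \<in> U ` I"
    using Union_in_chain[OF \<F>(1)] \<F>(2) by blast
  then obtain i where "i \<in> I" "K \<subseteq> U i"
    using \<F>(3) by auto
  then show ?thesis
    by (auto simp: U_def)
qed

section \<open>The axioms on \<open>X\<close> as separate rules\<close>

lemma quasi_kappa_metric_nonneg:
  assumes "quasi_kappa_metric X \<rho>" and "regularly_closed X C" and "x \<in> topspace X"
  shows "0 \<le> \<rho> x C"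
  using assms(1)[unfolded quasi_kappa_metric_def, THEN conjunct1] assms(2,3) by simp

lemma quasi_kappa_metric_positive:
  assumes "quasi_kappa_metric X \<rho>" and "regularly_closed X C"
  obtains V where "openin (subtopology X (topspace X - C)) V"
    "subtopology X (topspace X - C) closure_of V = topspace X - C"
    "\<And>x. x \<in> topspace X \<Longrightarrow> \<rho> x C > 0 \<longleftrightarrow> x \<in> V"
  using assms(1)[unfolded quasi_kappa_metric_def, THEN conjunct2, THEN conjunct1,
      rule_format, OF assms(2)] by blast

lemma quasi_kappa_metric_antimono:
  assumes "quasi_kappa_metric X \<rho>" and "regularly_closed X C" and "regularly_closed X C'"
    and "C \<subseteq> C'" and "x \<in> topspace X"
  shows "\<rho> x C' \<le> \<rho> x C"
  using assms(1)[unfolded quasi_kappa_metric_def, THEN conjunct2, THEN conjunct2, THEN conjunct1]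
    assms(2-5) by simp

lemma quasi_kappa_metric_continuous:
  assumes "quasi_kappa_metric X \<rho>" and "regularly_closed X C"
  shows "continuous_map X euclideanreal (\<lambda>x. \<rho> x C)"
  using assms(1)[unfolded quasi_kappa_metric_def, THEN conjunct2, THEN conjunct2, THEN conjunct2,
      THEN conjunct1] assms(2) by simp

section \<open>The axioms for the push-forward\<close>

text \<open>The preimages \<open>D\<close> form an increasing family in \<open>X\<close>, so K4 for
  \<rho> expresses \<open>h\<close> as the pointwise infimum of the functions
  \<open>g \<alpha>\<close>. It remains to interchange this infimum with the supremum over the
  fiber.\<close>

lemma pushforward_transfinite:
  fixes X :: "'a topology" and Y :: "'b topology" and r :: "'i rel"
  assumes f: "perfect_map X Y f" "open_map X Y f" and \<rho>: "quasi_kappa_metric X \<rho>"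
    and C: "increasing_family Y r C" and y: "y \<in> topspace Y"
  shows "pushforward X f \<rho> y (Y closure_of (\<Union>\<alpha>\<in>Field r. C \<alpha>))
    = (INF \<alpha>\<in>Field r. pushforward X f \<rho> y (C \<alpha>))"
proof -
  have cont: "continuous_map X Y f"
    using f by (simp add: perfect_map_def)
  define D where "D \<alpha> = {x \<in> topspace X. f x \<in> C \<alpha>}" for \<alpha>
  define E where "E = X closure_of (\<Union>\<alpha>\<in>Field r. D \<alpha>)"
  define g where "g \<alpha> x = \<rho> x (D \<alpha>)" for \<alpha> x
  define h where "h x = \<rho> x E" for x
  have C_closed: "\<And>\<alpha>. \<alpha> \<in> Field r \<Longrightarrow> regularly_closed Y (C \<alpha>)"
    and wo: "Well_order r" and ne: "Field r \<noteq> {}"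
    and inc: "\<And>\<alpha> \<beta>. (\<alpha>, \<beta>) \<in> r \<Longrightarrow> C \<alpha> \<subseteq> C \<beta>"
    using C by (auto simp: increasing_family_def)
  have D_closed: "regularly_closed X (D \<alpha>)" if "\<alpha> \<in> Field r" for \<alpha>
    unfolding D_def using regularly_closed_vimage[OF cont f(2) C_closed[OF that]] .
  have D_inc: "D \<alpha> \<subseteq> D \<beta>" if "(\<alpha>, \<beta>) \<in> r" for \<alpha> \<beta>
    using inc[OF that] by (auto simp: D_def)
  have D: "increasing_family X r D"
    using wo ne D_closed D_inc by (auto simp: increasing_family_def)
  have E_closed: "regularly_closed X E"
    unfolding E_def using D_closed by (intro regularly_closed_closure_Union) auto
  have D_sub: "D \<alpha> \<subseteq> E" if "\<alpha> \<in> Field r" for \<alpha>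
  proof -
    have "(\<Union>\<alpha>\<in>Field r. D \<alpha>) \<subseteq> topspace X"
      by (auto simp: D_def)
    then show ?thesis
      using that closure_of_subset unfolding E_def by fast
  qed
  \<comment> \<open>Because preimages under \<open>f\<close> commute with closure, the left-hand
    side of the claim is the fiber supremum of \<open>h\<close>.\<close>
  have vimage: "{x \<in> topspace X. f x \<in> Y closure_of (\<Union>\<alpha>\<in>Field r. C \<alpha>)} = E"
  proof -
    have "(\<Union>\<alpha>\<in>Field r. C \<alpha>) \<subseteq> topspace Y"
      using C_closed regularly_closed_subset by blast
    moreover have "{x \<in> topspace X. f x \<in> (\<Union>\<alpha>\<in>Field r. C \<alpha>)} = (\<Union>\<alpha>\<in>Field r. D \<alpha>)"
      by (auto simp: D_def)
    ultimately show ?thesis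
      using open_continuous_vimage_closure_of[OF cont f(2)] by (simp add: E_def)
  qed
  have g_cont: "continuous_map X euclideanreal (g \<alpha>)" if "\<alpha> \<in> Field r" for \<alpha>
    unfolding g_def using quasi_kappa_metric_continuous[OF \<rho> D_closed[OF that]] .
  have h_cont: "continuous_map X euclideanreal h"
    unfolding h_def using quasi_kappa_metric_continuous[OF \<rho> E_closed] .
  have h_le: "h x \<le> g \<alpha> x" if "\<alpha> \<in> Field r" "x \<in> topspace X" for \<alpha> x
    unfolding h_def g_def
    using quasi_kappa_metric_antimono[OF \<rho> D_closed[OF that(1)] E_closed D_sub[OF that(1)] that(2)] .
  \<comment> \<open>K4 for \<open>X\<close> is stated for indices of type \<open>'a set\<close>,
    while K4 for \<open>Y\<close> will require \<open>'b set\<close>; the version for arbitrary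
    index types bridges the two.\<close>
  have h_INF: "h x = (INF \<alpha>\<in>Field r. g \<alpha> x)" if "x \<in> topspace X" for x
    unfolding h_def g_def E_def using quasi_kappa_metric_transfinite[OF \<rho> D that] .
  have lower: "fiber_sup X f h y \<le> fiber_sup X f (g \<alpha>) y" if "\<alpha> \<in> Field r" for \<alpha>
    using fiber_sup_mono[OF f(1) h_cont g_cont[OF that] y] h_le[OF that] .
  \<comment> \<open>The nontrivial half of the interchange. For any \<open>c\<close> above the fiber
    supremum of \<open>h\<close>, compactness provides one index that works on the whole
    fiber.\<close>
  have "(INF \<alpha>\<in>Field r. fiber_sup X f (g \<alpha>) y) \<le> fiber_sup X f h y"
  proof (rule dense_ge)
    fix c assume c: "fiber_sup X f h y < c"
    let ?F = "{x \<in> topspace X. f x = y}"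
    have less: "\<exists>\<alpha>\<in>Field r. g \<alpha> x < c" if "x \<in> ?F" for x
    proof -
      have "(INF \<alpha>\<in>Field r. g \<alpha> x) < c"
        using c fiber_sup_upper[OF f(1) h_cont, of x] h_INF[of x] that by auto
      moreover have "bdd_below ((\<lambda>\<alpha>. g \<alpha> x) ` Field r)"
        using h_le that by (intro bdd_belowI2[of _ "h x"]) auto
      ultimately show ?thesis
        using cINF_less_iff ne by metis
    qed
    have compact: "compactin X ?F"
      using f(1) y by (simp add: perfect_map_def proper_map_def)
    have nonempty: "?F \<noteq> {}"
      using fiber_sup_attained[OF f(1) h_cont y] by auto
    \<comment> \<open>Totality of \<open>r\<close> makes the preimages comparable, and K2 turns
      their inclusion into a pointwise inequality.\<close>
    have chain: "(\<forall>x\<in>topspace X. g \<alpha> x \<le> g \<beta> x) \<or> (\<forall>x\<in>topspace X. g \<beta> x \<le> g \<alpha> x)"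
      if "\<alpha> \<in> Field r" "\<beta> \<in> Field r" for \<alpha> \<beta>
    proof -
      have "(\<alpha>, \<beta>) \<in> r \<or> (\<beta>, \<alpha>) \<in> r"
        using wo that
        by (cases "\<alpha> = \<beta>") (auto simp: order_on_defs total_on_def refl_on_def)
      then have "D \<alpha> \<subseteq> D \<beta> \<or> D \<beta> \<subseteq> D \<alpha>"
        using D_inc by blast
      then show ?thesis
        unfolding g_def
        using quasi_kappa_metric_antimono[OF \<rho> D_closed[OF that(1)] D_closed[OF that(2)]]
          quasi_kappa_metric_antimono[OF \<rho> D_closed[OF that(2)] D_closed[OF that(1)]] by blast
    qed
    obtain \<alpha> where \<alpha>: "\<alpha> \<in> Field r" "\<forall>x\<in>?F. g \<alpha> x < c"
      using compactin_chain_less[OF compact nonempty g_cont chain less] by (rule bexE)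
    \<comment> \<open>Since the supremum is attained in the fiber, the pointwise bound by
      \<open>c\<close> passes to it.\<close>
    obtain x where "x \<in> ?F" "fiber_sup X f (g \<alpha>) y = g \<alpha> x"
      using fiber_sup_attained[OF f(1) g_cont[OF \<alpha>(1)] y] by auto
    then have "fiber_sup X f (g \<alpha>) y < c"
      using \<alpha>(2) by simp
    moreover have "(INF \<alpha>\<in>Field r. fiber_sup X f (g \<alpha>) y) \<le> fiber_sup X f (g \<alpha>) y"
      using lower \<alpha>(1) by (intro cINF_lower bdd_belowI2[of _ "fiber_sup X f h y"]) auto
    ultimately show "(INF \<alpha>\<in>Field r. fiber_sup X f (g \<alpha>) y) \<le> c"
      by linarith
  qed
  moreover have "fiber_sup X f h y \<le> (INF \<alpha>\<in>Field r. fiber_sup X f (g \<alpha>) y)"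
    using ne lower by (intro cINF_greatest) auto
  ultimately have "fiber_sup X f h y = (INF \<alpha>\<in>Field r. fiber_sup X f (g \<alpha>) y)"
    by (rule antisym[rotated])
  then show ?thesis
    unfolding pushforward_def vimage h_def[abs_def] g_def[abs_def] D_def .
qed

lemma pushforward_positive:
  assumes f: "perfect_map X Y f" "open_map X Y f" and \<rho>: "quasi_kappa_metric X \<rho>"
    and C: "regularly_closed Y C"
  shows "\<exists>V. openin (subtopology Y (topspace Y - C)) V \<and>
    subtopology Y (topspace Y - C) closure_of V = topspace Y - C \<and>
    (\<forall>y\<in>topspace Y. pushforward X f \<rho> y C > 0 \<longleftrightarrow> y \<in> V)"
proof -
  have cont: "continuous_map X Y f" and surj: "f ` topspace X = topspace Y"
    using f by (auto simp: perfect_map_def)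
  define D where "D = {x \<in> topspace X. f x \<in> C}"
  have D: "regularly_closed X D"
    unfolding D_def using regularly_closed_vimage[OF cont f(2) C] .
  obtain V where V: "openin (subtopology X (topspace X - D)) V"
    "subtopology X (topspace X - D) closure_of V = topspace X - D"
    "\<And>x. x \<in> topspace X \<Longrightarrow> \<rho> x D > 0 \<longleftrightarrow> x \<in> V"
    using quasi_kappa_metric_positive[OF \<rho> D] by metis
  \<comment> \<open>Openness of \<open>V\<close> relative to the complement of \<open>D\<close>
    becomes openness in \<open>X\<close>, as \<open>open_map\<close> requires.\<close>
  have "openin X (topspace X - D)"
    using D by (auto simp: regularly_closed_def)
  then have V_open: "openin X V" and V_sub: "V \<subseteq> topspace X - D"
    using V(1) by (auto simp: openin_open_subtopology)
  have fV_sub: "f ` V \<subseteq> topspace Y - C"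
    using V_sub surj by (auto simp: D_def)
  have fV_open: "openin (subtopology Y (topspace Y - C)) (f ` V)"
    using f(2) V_open fV_sub by (auto simp: open_map_def openin_subtopology)
  have V_dense: "topspace X - D \<subseteq> X closure_of V"
    using V(2) closure_of_subtopology_subset by metis
  \<comment> \<open>Equality holds because \<open>D\<close> is a full preimage, hence a union of
    fibers.\<close>
  have "f ` (topspace X - D) = topspace Y - C"
    using surj by (auto simp: D_def)
  moreover have "f ` (X closure_of V) \<subseteq> Y closure_of (f ` V)"
    using cont by (simp add: continuous_map_image_closure_subset)
  ultimately have "topspace Y - C \<subseteq> Y closure_of (f ` V)"
    using V_dense by blast
  then have "subtopology Y (topspace Y - C) closure_of (f ` V) = topspace Y - C"
    using fV_sub by (auto simp: closure_of_subtopology inf.absorb2)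
  moreover have "pushforward X f \<rho> y C > 0 \<longleftrightarrow> y \<in> f ` V" if "y \<in> topspace Y" for y
  proof -
    have "{x \<in> topspace X. 0 < \<rho> x D} = V"
      using V(3) V_sub by auto
    then show ?thesis
      using less_fiber_sup_eq_image[OF f(1) quasi_kappa_metric_continuous[OF \<rho> D], of 0] that
      by (auto simp: pushforward_def D_def)
  qed
  ultimately show ?thesis
    using fV_open by blast
qed

lemma quasi_kappa_metric_pushforward:
  assumes f: "perfect_map X Y f" "open_map X Y f" and \<rho>: "quasi_kappa_metric X \<rho>"
  shows "quasi_kappa_metric Y (pushforward X f \<rho>)"
proof -
  have "continuous_map X Y f"
    using f by (simp add: perfect_map_def)
  note closed = regularly_closed_vimage[OF this f(2)]
  note cont = quasi_kappa_metric_continuous[OF \<rho> closed]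
  have "0 \<le> pushforward X f \<rho> y C" if y: "y \<in> topspace Y" and C: "regularly_closed Y C" for y C
  proof -
    obtain x where "x \<in> topspace X" "f x = y"
      "pushforward X f \<rho> y C = \<rho> x {x \<in> topspace X. f x \<in> C}"
      using fiber_sup_attained[OF f(1) cont[OF C] y] unfolding pushforward_def .
    then show ?thesis
      using quasi_kappa_metric_nonneg[OF \<rho> closed[OF C]] by simp
  qed
  moreover have "pushforward X f \<rho> y C' \<le> pushforward X f \<rho> y C"
    if "regularly_closed Y C" "regularly_closed Y C'" "C \<subseteq> C'" "y \<in> topspace Y" for y C C'
  proof -
    have "{x \<in> topspace X. f x \<in> C} \<subseteq> {x \<in> topspace X. f x \<in> C'}"
      using that(3) by auto
    then show ?thesis
      unfolding pushforward_def
      using quasi_kappa_metric_antimono[OF \<rho> closed[OF that(1)] closed[OF that(2)]]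
      by (intro fiber_sup_mono[OF f(1) cont[OF that(2)] cont[OF that(1)] that(4)])
  qed
  moreover have "continuous_map Y euclideanreal (\<lambda>y. pushforward X f \<rho> y C)"
    if "regularly_closed Y C" for C
    unfolding pushforward_def using continuous_map_fiber_sup[OF f cont[OF that]] .
  ultimately show ?thesis
    unfolding quasi_kappa_metric_def
    using pushforward_positive[OF f \<rho>] pushforward_transfinite[OF f \<rho>]
    by (intro conjI allI ballI impI) simp_all
qed

text \<open>For K5, choose \<open>x\<close> over \<open>y\<close> where \<rho> at the preimage of
  \<open>C\<close> is largest and apply K5 in \<open>X\<close> there. The left-hand side is then
  exact, while both terms on the right can only grow when pushed forward.\<close>

lemma regular_quasi_kappa_metric_pushforward:
  assumes f: "perfect_map X Y f" "open_map X Y f" and \<rho>: "regular_quasi_kappa_metric X \<rho>"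
  shows "regular_quasi_kappa_metric Y (pushforward X f \<rho>)"
proof -
  have \<rho>': "quasi_kappa_metric X \<rho>"
    using \<rho> by (simp add: regular_quasi_kappa_metric_def)
  have "continuous_map X Y f"
    using f by (simp add: perfect_map_def)
  note closed = regularly_closed_vimage[OF this f(2)]
  note cont = quasi_kappa_metric_continuous[OF \<rho>' closed]
  have "ennreal (pushforward X f \<rho> y C)
      \<le> ennreal (pushforward X f \<rho> y C') + rho_bar (pushforward X f \<rho>) C' C"
    if y: "y \<in> topspace Y" and C: "regularly_closed Y C" "regularly_closed Y C'" for y C C'
  proof -
    define D where "D = {x \<in> topspace X. f x \<in> C}"
    define D' where "D' = {x \<in> topspace X. f x \<in> C'}"
    obtain x where x: "x \<in> topspace X" "f x = y" "pushforward X f \<rho> y C = \<rho> x D"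
      using fiber_sup_attained[OF f(1) cont[OF C(1)] y] unfolding pushforward_def D_def .
    have le: "\<rho> z {x \<in> topspace X. f x \<in> B} \<le> pushforward X f \<rho> (f z) B"
      if "z \<in> topspace X" "regularly_closed Y B" for z B
      using fiber_sup_upper[OF f(1) cont[OF that(2)] that(1)] by (simp add: pushforward_def)
    \<comment> \<open>Each \<open>z\<close> in \<open>D'\<close> lies over the point
      \<open>f z\<close> of \<open>C'\<close>, whose push-forward value dominates the value of
      \<rho> at \<open>z\<close>.\<close>
    have "rho_bar \<rho> D' D \<le> rho_bar (pushforward X f \<rho>) C' C"
      unfolding rho_bar_def
    proof (rule SUP_least)
      fix z assume "z \<in> D'"
      then have "z \<in> topspace X" "f z \<in> C'"
        by (auto simp: D'_def)
      then show "ennreal (\<rho> z D) \<le> (SUP y\<in>C'. ennreal (pushforward X f \<rho> y C))"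
        using le[OF _ C(1)] unfolding D_def by (intro SUP_upper2[of "f z"] ennreal_leI)
    qed
    moreover have "ennreal (\<rho> x D') \<le> ennreal (pushforward X f \<rho> y C')"
      using le[OF x(1) C(2)] x(2) by (simp add: D'_def ennreal_leI)
    moreover have "ennreal (\<rho> x D) \<le> ennreal (\<rho> x D') + rho_bar \<rho> D' D"
      using \<rho> x(1) closed[OF C(1)] closed[OF C(2)]
      unfolding regular_quasi_kappa_metric_def D_def D'_def by blast
    ultimately show ?thesis
      unfolding x(3) by (meson add_mono order_trans)
  qed
  then show ?thesis
    using quasi_kappa_metric_pushforward[OF f \<rho>'] by (simp add: regular_quasi_kappa_metric_def)
qed

theorem proposition3p5:
  fixes X :: "'a topology" and Y :: "'b topology" and f :: "'a \<Rightarrow> 'b"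
  assumes "tychonoff_space X" and "tychonoff_space Y"
    and "perfect_map X Y f" and "open_map X Y f"
  shows "(quasi_kappa_metrizable X \<longrightarrow> quasi_kappa_metrizable Y) \<and>
         (regularly_quasi_kappa_metrizable X \<longrightarrow> regularly_quasi_kappa_metrizable Y)"
  using quasi_kappa_metric_pushforward[OF assms(3,4)]
    regular_quasi_kappa_metric_pushforward[OF assms(3,4)]
  unfolding quasi_kappa_metrizable_def regularly_quasi_kappa_metrizable_def by blast

end
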